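(* Let $T:X\to X$ be a diffeomorphism of a finite-dimensional complex Banach space $X$ with fixed point $0$, having a power series around $0$, with $T'(0)$ diagonalizable with nonzero eigenvalues and non-resonant principle eigenfunctions, and let $\tau_m:U_m\to V_m$ ($m\ge 2$) be the approximate conjugacies built from normal form transformations $\Phi_2,\Phi_3,\dots$ of $T$ (see context). Let $\psi\in\mathcal A_{T'(0)}$ be an eigenfunction of $U_{T'(0)}$ at eigenvalue $\mu\in\mathbb C$, let $m\ge 2$, and let $x=\tau_m(z)$ for $z\in U_m$. Then $$U_T(\psi\circ\tau_m^{-1})(x)=\mu\,(\psi\circ\tau_m^{-1})(x)+\mathcal O(\|z\|^{m+1})\qquad\text{as } z\to 0.$$
   Context: Koopman operators: $(U_Tf)(x)=f(T(x))$ and $(U_{T'(0)}f)(x)=f(T'(0)x)$; here $U_T$ is applied to functions on the $T$-invariant set $V_m$. Principle eigenfunctions: let $n=\dim X$, $\{e_1,\dots,e_n\}$ a basis of eigenvectors, $T'(0)e_i=\lambda_ie_i$, and $\{\phi_1,\dots,\phi_n\}\subset X^*$ the dual basis; the $\phi_i$ are the principle eigenfunctions of $U_{T'(0)}$. They are non-resonant if $\lambda_j\ne\lambda_1^{\alpha_1}\cdots\lambda_n^{\alpha_n}$ for all $j\in\{1,\dots,n\}$ and all $\alpha\in\mathbb N_0^n$ with $|\alpha|=\alpha_1+\dots+\alpha_n\ge 2$. The principle algebra $\mathcal A_{T'(0)}\subset C(X)$ is the complex algebra generated by $\phi_1,\dots,\phi_n$ together with the constant functions. $\mathcal P({}^mX;X)$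 is the space of continuous $m$-homogeneous polynomials $X\to X$, i.e. maps $x\mapsto A(x,\dots,x)$ with $A$ an $m$-linear map $X^m\to X$. A power series around $0$ is a sum $\sum_{m\ge0}P_m(x)$ with $P_m$ $m$-homogeneous (converging near $0$). $B_r=\{x\in X:\|x\|<r\}$. Normal form transformations: for each $m\ge2$ we are given $\epsilon_m\in(0,1)$ and $\Phi_m=I_X+Q_m$ with $Q_m\in\mathcal P({}^mX;X)$ such that $\Phi_m$ has a $C^1$ inverse $\Phi_m^{-1}:\Phi_m(B_{\epsilon_m})\to B_{\epsilon_m}$ (with $\Phi_m(B_{\epsilon_m})$ an open neighborhood of $0$) and, setting $T_1=T$ and $T_m=\Phi_m^{-1}\circ T_{m-1}\circ\Phi_m$ near $0$, one has $T_m(z)=T'(0)z+R_{m+1}(z)$ near $0$, where $R_{m+1}$ is a power series about $0$ with $R_{m+1}(z)\in\mathcal O(\|z\|^{m+1})$ as $z\to0$. Approximate conjugacies: write $B_{(k)}:=B_{\epsilon_k}$. For $m\ge2$ let $$\hat U_m=\bigcap_{j=1}^{m-2}\{z\in B_{(m)} : \Phi_{m-j+1}\circ\cdots\circ\Phi_m(z)\in B_{(m-j)}\}$$ (with $\hat U_2=B_{(2)}$) and $\hat V_m=\Phi_2\circ\cdots\circ\Phi_m(\hat U_m)$. Let $V_m\subset\hat V_m$ be a neighborhood of $0$ with $T(V_m)\subset V_m$, and $U_m=\Phi_m^{-1}\circ\cdots\circ\Phi_2^{-1}(V_m)\subset\hat U_m$. Then $\tau_m:=\Phi_2\circ\cdots\circ\Phi_m:U_m\to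 V_m$, with inverse $\tau_m^{-1}=\Phi_m^{-1}\circ\cdots\circ\Phi_2^{-1}:V_m\to U_m$. *)

theory Defs
  imports "HOL-Analysis.Analysis" "HOL-Library.Landau_Symbols"
begin

section \<open>Complex Banach spaces\<close>

class complex_normed_vector = real_normed_vector +
  fixes scaleC :: "complex \<Rightarrow> 'a \<Rightarrow> 'a"  (infixr \<open>*\<^sub>C\<close> 75)
  assumes scaleC_add_right: "a *\<^sub>C (x + y) = a *\<^sub>C x + a *\<^sub>C y"
    and scaleC_add_left: "(a + b) *\<^sub>C x = a *\<^sub>C x + b *\<^sub>C x"
    and scaleC_scaleC: "a *\<^sub>C b *\<^sub>C x = (a * b) *\<^sub>C x"
    and scaleC_one: "1 *\<^sub>C x = x"
    and scaleR_scaleC: "r *\<^sub>R x = complex_of_real r *\<^sub>C x"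
    and norm_scaleC: "norm (a *\<^sub>C x) = cmod a * norm x"

class complex_banach = complex_normed_vector + banach

global_interpretation complex_vector: vector_space "scaleC :: complex \<Rightarrow> 'a \<Rightarrow> 'a::complex_normed_vector"
  by unfold_locales
    (simp_all add: scaleC_add_right scaleC_add_left scaleC_scaleC scaleC_one)

abbreviation clinear :: "('a::complex_normed_vector \<Rightarrow> 'b::complex_normed_vector) \<Rightarrow> bool" where
  "clinear \<equiv> Vector_Spaces.linear scaleC scaleC"

definition topological_dual :: "('a::complex_normed_vector \<Rightarrow> complex) set" where
  "topological_dual = {f. Vector_Spaces.linear scaleC (*) f \<and> continuous_on UNIV f}"

text \<open>A basis is an indexed family \<open>e 1, \<dots>, e n\<close>; having one makes the space
  finite-dimensional, of complex dimension \<open>n\<close>.\<close>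

definition is_basis :: "nat \<Rightarrow> (nat \<Rightarrow> 'a::complex_normed_vector) \<Rightarrow> bool" where
  "is_basis n e \<longleftrightarrow> inj_on e {1..n} \<and> complex_vector.independent (e ` {1..n})
     \<and> complex_vector.span (e ` {1..n}) = UNIV"

definition is_dual_basis ::
  "nat \<Rightarrow> (nat \<Rightarrow> 'a::complex_normed_vector) \<Rightarrow> (nat \<Rightarrow> 'a \<Rightarrow> complex) \<Rightarrow> bool" where
  "is_dual_basis n e \<phi> \<longleftrightarrow> (\<forall>i\<in>{1..n}. \<phi> i \<in> topological_dual
     \<and> (\<forall>j\<in>{1..n}. \<phi> i (e j) = (if i = j then 1 else 0)))"


section \<open>Homogeneous polynomials and power series\<close>

text \<open>A map of \<open>k\<close> arguments is a map on sequences that depends on the entries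
  \<open>0, \<dots>, k - 1\<close> only.\<close>

definition multilinear ::
  "nat \<Rightarrow> ((nat \<Rightarrow> 'a::complex_normed_vector) \<Rightarrow> 'b::complex_normed_vector) \<Rightarrow> bool" where
  "multilinear k A \<longleftrightarrow> (\<forall>v w. (\<forall>i<k. v i = w i) \<longrightarrow> A v = A w)
     \<and> (\<forall>v. \<forall>i<k. clinear (\<lambda>x. A (v(i := x))))"

definition homogeneous_polynomials ::
  "nat \<Rightarrow> ('a::complex_normed_vector \<Rightarrow> 'b::complex_normed_vector) set" where
  "homogeneous_polynomials k =
     {P. continuous_on UNIV P \<and> (\<exists>A. multilinear k A \<and> (\<forall>x. P x = A (\<lambda>_. x)))}"

definition has_power_series_at_0 ::
  "('a::complex_normed_vector \<Rightarrow> 'b::complex_normed_vector) \<Rightarrow> bool" where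
  "has_power_series_at_0 f \<longleftrightarrow>
     (\<exists>P. (\<forall>k. P k \<in> homogeneous_polynomials k) \<and> (\<forall>\<^sub>F x in nhds 0. (\<lambda>k. P k x) sums f x))"


section \<open>Continuously differentiable maps\<close>

text \<open>Derivatives are real Frechet derivatives. For a map with a power series at \<open>0\<close>
  the derivative near \<open>0\<close> is automatically complex linear.\<close>

definition C1_on ::
  "'a set \<Rightarrow> ('a::real_normed_vector \<Rightarrow> 'b::real_normed_vector) \<Rightarrow> bool" where
  "C1_on S f \<longleftrightarrow> (\<exists>f'. (\<forall>x\<in>S. (f has_derivative blinfun_apply (f' x)) (at x)) \<and> continuous_on S f')"

definition diffeomorphism :: "('a::real_normed_vector \<Rightarrow> 'b::real_normed_vector) \<Rightarrow> bool" where
  "diffeomorphism T \<longleftrightarrow> bij T \<and> C1_on UNIV T \<and> C1_on UNIV (inv T)"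

abbreviation deriv0 :: "('a::real_normed_vector \<Rightarrow> 'b::real_normed_vector) \<Rightarrow> 'a \<Rightarrow> 'b" where
  "deriv0 T \<equiv> frechet_derivative T (at 0)"


section \<open>Koopman operators and the principle algebra\<close>

definition koopman :: "('a \<Rightarrow> 'a) \<Rightarrow> ('a \<Rightarrow> 'b) \<Rightarrow> 'a \<Rightarrow> 'b" where
  "koopman T f = (\<lambda>x. f (T x))"

definition koopman_eigenfunction :: "('a \<Rightarrow> 'a) \<Rightarrow> complex \<Rightarrow> ('a \<Rightarrow> complex) \<Rightarrow> bool" where
  "koopman_eigenfunction T \<mu> \<psi> \<longleftrightarrow> \<psi> \<noteq> (\<lambda>_. 0) \<and> koopman T \<psi> = (\<lambda>x. \<mu> * \<psi> x)"

definition non_resonant :: "nat \<Rightarrow> (nat \<Rightarrow> complex) \<Rightarrow> bool" where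
  "non_resonant n \<Lambda> \<longleftrightarrow> (\<forall>j\<in>{1..n}. \<forall>\<alpha>::nat \<Rightarrow> nat.
     (\<Sum>i=1..n. \<alpha> i) \<ge> 2 \<longrightarrow> \<Lambda> j \<noteq> (\<Prod>i=1..n. \<Lambda> i ^ \<alpha> i))"

text \<open>Closure under complex scalars follows from closure under products, as the constants
  belong to the algebra.\<close>

inductive_set principle_algebra :: "nat \<Rightarrow> (nat \<Rightarrow> 'a \<Rightarrow> complex) \<Rightarrow> ('a \<Rightarrow> complex) set"
  for n \<phi> where
  const: "(\<lambda>_. c) \<in> principle_algebra n \<phi>"
| gen: "i \<in> {1..n} \<Longrightarrow> \<phi> i \<in> principle_algebra n \<phi>"
| add: "f \<in> principle_algebra n \<phi> \<Longrightarrow> g \<in> principle_algebra n \<phi> \<Longrightarrow>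
    (\<lambda>x. f x + g x) \<in> principle_algebra n \<phi>"
| mult: "f \<in> principle_algebra n \<phi> \<Longrightarrow> g \<in> principle_algebra n \<phi> \<Longrightarrow>
    (\<lambda>x. f x * g x) \<in> principle_algebra n \<phi>"


section \<open>Normal form transformations and approximate conjugacies\<close>

text \<open>Local inverses are total functions; \<open>local_inv \<epsilon> \<Phi> m\<close> is meaningful only on
  \<open>\<Phi> m ` ball 0 (\<epsilon> m)\<close>.\<close>

definition local_inv ::
  "(nat \<Rightarrow> real) \<Rightarrow> (nat \<Rightarrow> 'a \<Rightarrow> 'a) \<Rightarrow> nat \<Rightarrow> 'a \<Rightarrow> 'a::real_normed_vector" where
  "local_inv \<epsilon> \<Phi> m = inv_into (ball 0 (\<epsilon> m)) (\<Phi> m)"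

text \<open>\<open>transformed T \<epsilon> \<Phi> m\<close> is the map \<open>T\<^sub>m\<close>, starting with \<open>T\<^sub>1 = T\<close>
  (the value at index \<open>0\<close> is a dummy). Only its germ at \<open>0\<close> is significant.\<close>

fun transformed ::
  "('a \<Rightarrow> 'a) \<Rightarrow> (nat \<Rightarrow> real) \<Rightarrow> (nat \<Rightarrow> 'a \<Rightarrow> 'a) \<Rightarrow> nat \<Rightarrow> 'a \<Rightarrow> 'a::real_normed_vector" where
  "transformed T \<epsilon> \<Phi> 0 = T"
| "transformed T \<epsilon> \<Phi> (Suc 0) = T"
| "transformed T \<epsilon> \<Phi> (Suc (Suc k)) =
     local_inv \<epsilon> \<Phi> (Suc (Suc k)) \<circ> transformed T \<epsilon> \<Phi> (Suc k) \<circ> \<Phi> (Suc (Suc k))"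

definition normal_form_transformations ::
  "('a \<Rightarrow> 'a) \<Rightarrow> (nat \<Rightarrow> real) \<Rightarrow> (nat \<Rightarrow> 'a \<Rightarrow> 'a) \<Rightarrow> (nat \<Rightarrow> 'a \<Rightarrow> 'a::complex_banach) \<Rightarrow> bool" where
  "normal_form_transformations T \<epsilon> Q \<Phi> \<longleftrightarrow>
     (\<forall>m\<ge>2. 0 < \<epsilon> m \<and> \<epsilon> m < 1
        \<and> Q m \<in> homogeneous_polynomials m
        \<and> \<Phi> m = (\<lambda>z. z + Q m z)
        \<and> inj_on (\<Phi> m) (ball 0 (\<epsilon> m))
        \<and> open (\<Phi> m ` ball 0 (\<epsilon> m)) \<and> 0 \<in> \<Phi> m ` ball 0 (\<epsilon> m)
        \<and> C1_on (\<Phi> m ` ball 0 (\<epsilon> m)) (local_inv \<epsilon> \<Phi> m)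
        \<and> (\<exists>R. (\<forall>\<^sub>F z in nhds 0. transformed T \<epsilon> \<Phi> m z = deriv0 T z + R z)
              \<and> has_power_series_at_0 R
              \<and> (\<lambda>z. norm (R z)) \<in> O[at 0](\<lambda>z. norm z ^ (m + 1))))"

text \<open>\<open>comp_range \<Phi> k m = \<Phi> k \<circ> \<Phi> (k + 1) \<circ> \<dots> \<circ> \<Phi> m\<close>\<close>

definition comp_range :: "(nat \<Rightarrow> 'a \<Rightarrow> 'a) \<Rightarrow> nat \<Rightarrow> nat \<Rightarrow> 'a \<Rightarrow> 'a" where
  "comp_range \<Phi> k m = foldr (\<lambda>j f. \<Phi> j \<circ> f) [k..<Suc m] id"

definition tau :: "(nat \<Rightarrow> 'a \<Rightarrow> 'a) \<Rightarrow> nat \<Rightarrow> 'a \<Rightarrow> 'a" where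
  "tau \<Phi> m = comp_range \<Phi> 2 m"

text \<open>\<open>\<Phi>\<^sub>m\<inverse> \<circ> \<dots> \<circ> \<Phi>\<^sub>2\<inverse>\<close>\<close>

definition tau_inv ::
  "(nat \<Rightarrow> real) \<Rightarrow> (nat \<Rightarrow> 'a \<Rightarrow> 'a) \<Rightarrow> nat \<Rightarrow> 'a \<Rightarrow> 'a::real_normed_vector" where
  "tau_inv \<epsilon> \<Phi> m = foldr (\<lambda>j f. local_inv \<epsilon> \<Phi> j \<circ> f) (rev [2..<Suc m]) id"

definition U_hat ::
  "(nat \<Rightarrow> real) \<Rightarrow> (nat \<Rightarrow> 'a \<Rightarrow> 'a) \<Rightarrow> nat \<Rightarrow> 'a::real_normed_vector set" where
  "U_hat \<epsilon> \<Phi> m = {z \<in> ball 0 (\<epsilon> m).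
     \<forall>j\<in>{1..m-2}. comp_range \<Phi> (m - j + 1) m z \<in> ball 0 (\<epsilon> (m - j))}"

definition V_hat ::
  "(nat \<Rightarrow> real) \<Rightarrow> (nat \<Rightarrow> 'a \<Rightarrow> 'a) \<Rightarrow> nat \<Rightarrow> 'a::real_normed_vector set" where
  "V_hat \<epsilon> \<Phi> m = tau \<Phi> m ` U_hat \<epsilon> \<Phi> m"

text \<open>The choice of neighbourhoods \<open>V\<^sub>m\<close> and \<open>U\<^sub>m\<close> turning \<open>\<tau>\<^sub>m : U\<^sub>m \<rightarrow> V\<^sub>m\<close>
  into approximate conjugacies.\<close>

definition conjugacy_domains ::
  "('a \<Rightarrow> 'a) \<Rightarrow> (nat \<Rightarrow> real) \<Rightarrow> (nat \<Rightarrow> 'a \<Rightarrow> 'a) \<Rightarrow> (nat \<Rightarrow> 'a set)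
     \<Rightarrow> (nat \<Rightarrow> 'a::real_normed_vector set) \<Rightarrow> bool" where
  "conjugacy_domains T \<epsilon> \<Phi> U V \<longleftrightarrow>
     (\<forall>m\<ge>2. V m \<subseteq> V_hat \<epsilon> \<Phi> m \<and> 0 \<in> interior (V m) \<and> T ` V m \<subseteq> V m
        \<and> U m = tau_inv \<epsilon> \<Phi> m ` V m)"

end

theory Submission
  imports Defs
begin

text \<open>The recursion for \<open>T\<^sub>m\<close> telescopes to \<open>T\<^sub>m = \<tau>\<^sub>m\<inverse> \<circ> T \<circ> \<tau>\<^sub>m\<close>. Hence, as
  \<open>\<psi>\<close> is an eigenfunction for \<open>T'(0)\<close>, the defect in the eigenvalue equation at
  \<open>x = \<tau>\<^sub>m(z)\<close> is \<open>\<psi>(T'(0)z + R(z)) - \<psi>(T'(0)z)\<close> with \<open>R(z) = O(\<parallel>z\<parallel>\<^bsup>m+1\<^esup>)\<close>.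
  Elements of the principle algebra are Lipschitz on bounded sets, so this defect is
  of the order of \<open>R(z)\<close>.\<close>

lemma comp_range_Suc:
  assumes "k \<le> Suc m"
  shows "comp_range \<Phi> k (Suc m) = comp_range \<Phi> k m \<circ> \<Phi> (Suc m)"
proof -
  \<comment> \<open>The fold builds the composition from the left, so its last factor appears as the
    starting value; a general starting value \<open>g\<close> lets it be pulled out on the
    right.\<close>
  have "foldr (\<lambda>j f. \<Phi> j \<circ> f) xs g = foldr (\<lambda>j f. \<Phi> j \<circ> f) xs id \<circ> g" for xs g
    by (induction xs) (auto simp: comp_assoc)
  from this[of "[k..<Suc m]" "\<Phi> (Suc m)"] show ?thesis
    using assms by (simp add: comp_range_def upt_Suc[of k "Suc m"] del: upt_Suc)
qed

lemma comp_range_rec: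
  assumes "k \<le> m"
  shows "comp_range \<Phi> k m = \<Phi> k \<circ> comp_range \<Phi> (Suc k) m"
  using assms by (simp add: comp_range_def upt_conv_Cons del: upt_Suc)

lemma comp_range_empty: "m < k \<Longrightarrow> comp_range \<Phi> k m = id"
  by (simp add: comp_range_def)

lemma tau_inv_Suc:
  "1 \<le> k \<Longrightarrow> tau_inv \<epsilon> \<Phi> (Suc k) = local_inv \<epsilon> \<Phi> (Suc k) \<circ> tau_inv \<epsilon> \<Phi> k"
  by (simp add: tau_inv_def)

text \<open>Each recursion step adds \<open>local_inv\<close> on the left and \<open>\<Phi>\<close>
  on the right, exactly as \<open>tau_inv\<close> and \<open>tau\<close> grow. This is an identity
  of total functions, so no domains have to be tracked here.\<close>

lemma transformed_conjugacy:
  assumes "1 \<le> m"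
  shows "transformed T \<epsilon> \<Phi> m = tau_inv \<epsilon> \<Phi> m \<circ> T \<circ> tau \<Phi> m"
  using assms
proof (induction m rule: dec_induct)
  case base
  show ?case by (simp add: tau_inv_def tau_def comp_range_def)
next
  case (step k)
  have "transformed T \<epsilon> \<Phi> (Suc k)
      = local_inv \<epsilon> \<Phi> (Suc k) \<circ> transformed T \<epsilon> \<Phi> k \<circ> \<Phi> (Suc k)"
    using step.hyps(1) by (cases k) simp_all
  also have "\<dots> = tau_inv \<epsilon> \<Phi> (Suc k) \<circ> T \<circ> tau \<Phi> (Suc k)"
    unfolding step.IH using step.hyps(1)
    by (simp add: tau_inv_Suc tau_def comp_range_Suc comp_assoc)
  finally show ?case .
qed

text \<open>The conditions in \<open>U_hat\<close> place every intermediate point in the ball on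
  which the next \<open>\<Phi> k\<close> is injective, so the local inverses cancel the factors one
  by one, outermost first.\<close>

lemma tau_inv_tau:
  assumes inj: "\<And>k. 2 \<le> k \<Longrightarrow> k \<le> m \<Longrightarrow> inj_on (\<Phi> k) (ball 0 (\<epsilon> k))"
    and m: "2 \<le> m" and w: "w \<in> U_hat \<epsilon> \<Phi> m"
  shows "tau_inv \<epsilon> \<Phi> m (tau \<Phi> m w) = w"
proof -
  \<comment> \<open>This is the point to which \<open>\<Phi> k\<close> is applied. For
    \<open>k = m\<close> it is \<open>w\<close> itself; otherwise the condition in
    \<open>U_hat\<close> with \<open>j = m - k\<close> applies.\<close>
  have ball: "comp_range \<Phi> (Suc k) m w \<in> ball 0 (\<epsilon> k)" if "2 \<le> k" "k \<le> m" for k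
  proof (cases "k = m")
    case True
    then show ?thesis using w by (simp add: U_hat_def comp_range_empty)
  next
    case False
    with that have "m - k \<in> {1..m-2}" "m - (m - k) = k" by auto
    then show ?thesis using w unfolding U_hat_def by fastforce
  qed
  \<comment> \<open>The induction runs over the number of cancelled factors: none at
    \<open>k = 1\<close>, all of them at \<open>k = m\<close>, while \<open>tau \<Phi> m w\<close>
    stays fixed.\<close>
  have "k \<le> m \<Longrightarrow> tau_inv \<epsilon> \<Phi> k (tau \<Phi> m w) = comp_range \<Phi> (Suc k) m w" if "1 \<le> k" for k
    using that
  proof (induction k rule: dec_induct)
    case base
    show ?case by (simp add: tau_inv_def tau_def numeral_2_eq_2)
  next
    case (step k)
    then have "tau_inv \<epsilon> \<Phi> (Suc k) (tau \<Phi> m w)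
        = local_inv \<epsilon> \<Phi> (Suc k) (\<Phi> (Suc k) (comp_range \<Phi> (Suc (Suc k)) m w))"
      by (simp add: tau_inv_Suc comp_range_rec[of "Suc k"])
    also have "\<dots> = comp_range \<Phi> (Suc (Suc k)) m w"
      unfolding local_inv_def using step inj ball by (intro inv_into_f_f) auto
    finally show ?case .
  qed
  from this[of m] show ?thesis
    using m by (simp add: comp_range_empty)
qed

text \<open>A point of \<open>U m\<close> has the form \<open>tau_inv (tau w)\<close> with
  \<open>w\<close> in \<open>U_hat\<close>, hence equals that \<open>w\<close>.\<close>

lemma tau_inv_tau_on_U:
  assumes "normal_form_transformations T \<epsilon> Q \<Phi>" and "conjugacy_domains T \<epsilon> \<Phi> U V"
    and "2 \<le> m" and "z \<in> U m"
  shows "tau_inv \<epsilon> \<Phi> m (tau \<Phi> m z) = z"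
proof -
  from assms obtain w where w: "w \<in> U_hat \<epsilon> \<Phi> m" and z: "z = tau_inv \<epsilon> \<Phi> m (tau \<Phi> m w)"
    unfolding conjugacy_domains_def V_hat_def by blast
  have "tau_inv \<epsilon> \<Phi> m (tau \<Phi> m w) = w"
    using assms w by (intro tau_inv_tau) (auto simp: normal_form_transformations_def)
  with z show ?thesis by simp
qed

lemma topological_dual_bounded_linear:
  assumes "f \<in> topological_dual"
  shows "bounded_linear f"
proof -
  have lin: "Vector_Spaces.linear scaleC (*) f" and cont: "continuous_on UNIV f"
    using assms by (auto simp: topological_dual_def)
  interpret f: Vector_Spaces.linear scaleC "(*)" f by (fact lin)
  have scale: "f (r *\<^sub>R x) = r *\<^sub>R f x" for r x
    by (simp add: scaleR_scaleC f.scale scaleR_conv_of_real)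
  have "isCont f 0"
    using cont by (simp add: continuous_on_eq_continuous_at)
  then obtain d where d: "d > 0" "\<And>x. norm x < d \<Longrightarrow> norm (f x) < 1"
    unfolding continuous_at_eps_delta by (metis dist_0_norm dist_commute f.zero zero_less_one)
  have "norm (f x) \<le> norm x * (2 / d)" for x
  proof (cases "x = 0")
    case False
    \<comment> \<open>Rescaling \<open>x\<close> to norm \<open>d / 2\<close> brings it inside the
      ball where \<open>f\<close> is below 1; scaling back gives the bound
      \<open>2 / d\<close>.\<close>
    define c where "c = d / (2 * norm x)"
    have "c > 0" using d False by (simp add: c_def)
    have "norm (c *\<^sub>R x) < d" using d False by (simp add: c_def)
    then have "c * norm (f x) < 1" using d(2) \<open>c > 0\<close> by (fastforce simp: scale)
    then have "norm (f x) < 1 / c" using \<open>c > 0\<close> by (simp add: field_simps)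
    then show ?thesis by (simp add: c_def field_simps)
  qed (simp add: f.zero)
  then show ?thesis
    by (intro bounded_linear_intro[where K = "2 / d"]) (auto simp: f.add scale)
qed

text \<open>Boundedness of the image is carried through the induction because a product of Lipschitz
  functions is controlled only when both factors are bounded.\<close>

lemma principle_algebra_lipschitz_on_bounded:
  fixes \<phi> :: "nat \<Rightarrow> 'a::real_normed_vector \<Rightarrow> complex"
  assumes "\<psi> \<in> principle_algebra n \<phi>" and lin: "\<And>i. i \<in> {1..n} \<Longrightarrow> bounded_linear (\<phi> i)"
    and S: "bounded S"
  shows "\<exists>L. L-lipschitz_on S \<psi> \<and> bounded (\<psi> ` S)"
  using assms(1)
proof induction
  case (const c)
  have "0-lipschitz_on S (\<lambda>_. c)" by (simp add: lipschitz_on_def)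
  moreover have "bounded ((\<lambda>_. c) ` S)"
    by (rule bounded_subset[of "{c}"]) auto
  ultimately show ?case by blast
next
  case (gen i)
  then interpret bounded_linear "\<phi> i" by (rule lin)
  obtain B where "\<And>x. norm (\<phi> i x) \<le> norm x * B" "0 \<le> B"
    using nonneg_bounded by blast
  then have "B-lipschitz_on S (\<phi> i)"
    by (intro lipschitz_onI) (auto simp: dist_norm mult.commute simp flip: diff)
  moreover have "bounded (\<phi> i ` S)"
    using S by (rule bounded_linear_image) (rule bounded_linear_axioms)
  ultimately show ?case by blast
next
  case (add f g)
  then obtain L M where "L-lipschitz_on S f" "M-lipschitz_on S g" by blast
  then have "(L + M)-lipschitz_on S (\<lambda>x. f x + g x)" by (rule lipschitz_on_add)
  moreover have "bounded ((\<lambda>x. f x + g x) ` S)"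
    using add by (intro bounded_plus_comp) auto
  ultimately show ?case by blast
next
  case (mult f g)
  then obtain L M where L: "L-lipschitz_on S f" and M: "M-lipschitz_on S g"
    and bdd: "bounded (f ` S)" "bounded (g ` S)" by blast
  from bdd obtain a b where a: "a > 0" "\<And>x. x \<in> S \<Longrightarrow> norm (f x) \<le> a"
    and b: "b > 0" "\<And>x. x \<in> S \<Longrightarrow> norm (g x) \<le> b"
    unfolding bounded_pos by auto
  have "0 \<le> L" "0 \<le> M" using L M by (auto dest: lipschitz_on_nonneg)
  have "(a * M + b * L)-lipschitz_on S (\<lambda>x. f x * g x)"
  proof (rule lipschitz_onI)
    fix x y assume xy: "x \<in> S" "y \<in> S"
    have "f x * g x - f y * g y = f x * (g x - g y) + g y * (f x - f y)"
      by (simp add: algebra_simps)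
    then have "dist (f x * g x) (f y * g y) \<le> norm (f x) * dist (g x) (g y) + norm (g y) * dist (f x) (f y)"
      by (metis dist_norm norm_mult norm_triangle_ineq)
    also have "\<dots> \<le> a * (M * dist x y) + b * (L * dist x y)"
      using xy a b by (intro add_mono mult_mono lipschitz_onD[OF L] lipschitz_onD[OF M]) auto
    finally show "dist (f x * g x) (f y * g y) \<le> (a * M + b * L) * dist x y"
      by (simp add: algebra_simps)
  qed (use \<open>0 \<le> L\<close> \<open>0 \<le> M\<close> a b in auto)
  moreover have "bounded ((\<lambda>x. f x * g x) ` S)"
    unfolding bounded_iff
  proof (intro exI[of _ "a * b"] ballI)
    fix u assume "u \<in> (\<lambda>x. f x * g x) ` S"
    then show "norm u \<le> a * b"
      using a b by (auto simp: norm_mult intro!: mult_mono)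
  qed
  ultimately show ?case by blast
qed

lemma lipschitz_perturbation_bigo:
  fixes \<psi> :: "'a::real_normed_vector \<Rightarrow> complex"
  assumes lip: "\<And>S. bounded S \<Longrightarrow> \<exists>L. L-lipschitz_on S \<psi>"
    and A: "bounded_linear A"
    and R: "(\<lambda>z. norm (R z)) \<in> O[at 0](\<lambda>z::'a. norm z ^ k)"
  shows "(\<lambda>z. \<psi> (A z + R z) - \<psi> (A z)) \<in> O[at 0](\<lambda>z. complex_of_real (norm z ^ k))"
proof -
  from R obtain c where c: "c > 0" "\<forall>\<^sub>F z in at 0. norm (R z) \<le> c * norm z ^ k"
    by (elim landau_o.bigE) auto
  from bounded_linear.nonneg_bounded[OF A] obtain K
    where K: "0 \<le> K" "\<And>z. norm (A z) \<le> norm z * K" by blast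
  \<comment> \<open>For \<open>norm z < 1\<close> the bounds \<open>norm (A z) \<le> K\<close> and
    \<open>norm (R z) \<le> c\<close> hold, so one ball of radius \<open>K + c\<close> contains both
    arguments of \<open>\<psi>\<close>.\<close>
  obtain L where L: "L-lipschitz_on (cball 0 (K + c)) \<psi>"
    using lip bounded_cball by blast
  have "\<forall>\<^sub>F z in at (0::'a). norm z < 1"
    by (auto simp: eventually_at intro!: exI[of _ 1])
  with c(2) have "\<forall>\<^sub>F z in at 0. norm (\<psi> (A z + R z) - \<psi> (A z)) \<le> L * c * norm (complex_of_real (norm z ^ k))"
  proof eventually_elim
    case (elim z)
    have "norm z * K \<le> K"
      using elim K(1) mult_right_mono[of "norm z" 1 K] by simp
    then have Az: "norm (A z) \<le> K" using K(2)[of z] by simp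
    have "norm z ^ k \<le> 1" using elim by (simp add: power_le_one)
    then have "c * norm z ^ k \<le> c" using c by simp
    then have "norm (R z) \<le> c" using elim by simp
    then have "norm (A z + R z) \<le> K + c"
      using Az norm_triangle_ineq[of "A z" "R z"] by simp
    then have "dist (\<psi> (A z + R z)) (\<psi> (A z)) \<le> L * dist (A z + R z) (A z)"
      using Az c by (intro lipschitz_onD[OF L]) auto
    also have "\<dots> \<le> L * (c * norm z ^ k)"
      using elim lipschitz_on_nonneg[OF L] by (intro mult_left_mono) (auto simp: dist_norm)
    finally show ?case
      by (simp add: dist_norm norm_power mult.assoc)
  qed
  then show ?thesis by (rule bigoI)
qed

theorem proposition4p2:
  fixes T :: "'a::complex_banach \<Rightarrow> 'a"
    and n :: nat and e :: "nat \<Rightarrow> 'a" and \<Lambda> :: "nat \<Rightarrow> complex" and \<phi> :: "nat \<Rightarrow> 'a \<Rightarrow> complex"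
    and \<epsilon> :: "nat \<Rightarrow> real" and Q \<Phi> :: "nat \<Rightarrow> 'a \<Rightarrow> 'a" and U V :: "nat \<Rightarrow> 'a set"
    and \<psi> :: "'a \<Rightarrow> complex" and \<mu> :: complex and m :: nat
  assumes "diffeomorphism T" and "T 0 = 0" and "has_power_series_at_0 T"
    and "is_basis n e" and "\<And>i. i \<in> {1..n} \<Longrightarrow> deriv0 T (e i) = \<Lambda> i *\<^sub>C e i"
    and "\<And>i. i \<in> {1..n} \<Longrightarrow> \<Lambda> i \<noteq> 0"
    and "is_dual_basis n e \<phi>" and "non_resonant n \<Lambda>"
    and "normal_form_transformations T \<epsilon> Q \<Phi>"
    and "conjugacy_domains T \<epsilon> \<Phi> U V"
    and "\<psi> \<in> principle_algebra n \<phi>" and "koopman_eigenfunction (deriv0 T) \<mu> \<psi>"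
    and "m \<ge> 2"
  shows "(\<lambda>z. let x = tau \<Phi> m z in
            koopman T (\<psi> \<circ> tau_inv \<epsilon> \<Phi> m) x - \<mu> * (\<psi> \<circ> tau_inv \<epsilon> \<Phi> m) x)
         \<in> O[at 0 within U m](\<lambda>z. complex_of_real (norm z ^ (m + 1)))"
proof -
  obtain R where R: "\<forall>\<^sub>F z in nhds 0. transformed T \<epsilon> \<Phi> m z = deriv0 T z + R z"
      "(\<lambda>z. norm (R z)) \<in> O[at 0](\<lambda>z. norm z ^ (m + 1))"
    using assms(9,13) unfolding normal_form_transformations_def by blast
  \<comment> \<open>\<open>frechet_derivative\<close> is defined by choice, so
    \<open>deriv0 T\<close> is known to be bounded linear only after differentiability is
    established.\<close>
  have "T differentiable at 0"
    using assms(1) by (auto simp: diffeomorphism_def C1_on_def differentiable_def)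
  then have "bounded_linear (deriv0 T)"
    by (simp add: frechet_derivative_works has_derivative_bounded_linear)
  moreover have "bounded_linear (\<phi> i)" if "i \<in> {1..n}" for i
    using assms(7) that by (auto simp: is_dual_basis_def intro: topological_dual_bounded_linear)
  then have "\<exists>L. L-lipschitz_on S \<psi>" if "bounded S" for S
    using principle_algebra_lipschitz_on_bounded[OF assms(11) _ that] by blast
  ultimately have "(\<lambda>z. \<psi> (deriv0 T z + R z) - \<psi> (deriv0 T z))
      \<in> O[at 0](\<lambda>z. complex_of_real (norm z ^ (m + 1)))"
    using R(2) by (intro lipschitz_perturbation_bigo)
  then have bigo: "(\<lambda>z. \<psi> (deriv0 T z + R z) - \<psi> (deriv0 T z))
      \<in> O[at 0 within U m](\<lambda>z. complex_of_real (norm z ^ (m + 1)))"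
    by (rule landau_o.big.filter_mono[OF at_le[OF subset_UNIV]])
  have "\<forall>\<^sub>F z in at 0 within U m. transformed T \<epsilon> \<Phi> m z = deriv0 T z + R z"
    using R(1) by (auto simp: eventually_at_filter elim: eventually_mono)
  \<comment> \<open>Membership in \<open>U m\<close> is what allows \<open>tau_inv\<close> to cancel
    \<open>tau\<close> in the term with \<open>\<mu>\<close>; the expansion of
    \<open>transformed\<close> needs only closeness to 0.\<close>
  moreover have "\<forall>\<^sub>F z in at 0 within U m. z \<in> U m"
    by (simp add: eventually_at_filter)
  ultimately have "\<forall>\<^sub>F z in at 0 within U m.
      \<psi> (deriv0 T z + R z) - \<psi> (deriv0 T z) = (let x = tau \<Phi> m z in
        koopman T (\<psi> \<circ> tau_inv \<epsilon> \<Phi> m) x - \<mu> * (\<psi> \<circ> tau_inv \<epsilon> \<Phi> m) x)"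
  proof eventually_elim
    case (elim z)
    have "tau_inv \<epsilon> \<Phi> m (T (tau \<Phi> m z)) = deriv0 T z + R z"
      using elim assms(13) by (simp add: transformed_conjugacy)
    moreover have "tau_inv \<epsilon> \<Phi> m (tau \<Phi> m z) = z"
      using assms(9,10,13) elim by (intro tau_inv_tau_on_U)
    moreover have "\<psi> (deriv0 T z) = \<mu> * \<psi> z"
      using assms(12) by (auto simp: koopman_eigenfunction_def koopman_def dest: fun_cong)
    ultimately show ?case by (simp add: koopman_def)
  qed
  from landau_o.big.in_cong[OF this] bigo show ?thesis by blast
qed

end
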